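(* Let $\ell$ be a prime and $n\ge4$ an integer. Let $C_n$ be the cyclic group of order $n$, $C_n'=C_n\setminus\{1\}$, and let $K_n=\mathrm{Cay}(C_n,C_n')$ be the complete graph on $n$ vertices. Let $\beta:C_n'\to\mathbb{Z}_\ell$ satisfy conditions (1)–(4) below, let $\alpha=\alpha_\beta$, and let $\mu_n=\mu_\ell(K_n,\alpha)$, $\lambda_n=\lambda_\ell(K_n,\alpha)$. Suppose $\ell\nmid n$ and $\sum_{s\in C_n'}\beta(s)^2\not\equiv0\pmod\ell$. Then $\mu_n=0$ and $\lambda_n=1$.
   Context: For a finite abelian group $G$ and $S\subseteq G$ with $S$ generating $G$, $S=S^{-1}$, $1\notin S$, $\mathrm{Cay}(G,S)$ has vertices $\{v_g\}$ and a directed edge $e(g_1,g_2)$ from $v_{g_1}$ to $v_{g_2}$ whenever $g_1g_2^{-1}\in S$ (inverse $e(g_2,g_1)$); each vertex has degree $r=\#S$. Conditions on $\beta:S\to\mathbb{Z}_\ell$: (1) its image generates $\mathbb{Z}_\ell$ as a $\mathbb{Z}_\ell$-module; (2) $\beta(s^{-1})=-\beta(s)$; (3) $\beta(S)\subseteq\mathbb{Z}$; (4) there exist $m>0$ and $(h_1,\dots,h_m)\in S^m$ with $h_1\cdots h_m\in S$ and $\beta(h_1\cdots h_m)\not\equiv\sum_i\beta(h_i)\pmod\ell$. Voltage: $\alpha(e(g_1,g_2))=\beta(g_1g_2^{-1})$. Enumerating $G=\{g_1,\dots,g_N\}$, with $\delta_S$ the indicator of $S$ and $(1+T)^b=\sum_k\binom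 bkT^k$, the Iwasawa polynomial is $f_{X,\alpha}(T)=\det\big(r\delta_{ij}-\delta_S(g_ig_j^{-1})(1+T)^{\beta(g_ig_j^{-1})}\big)_{i,j}\in\mathbb{Z}_\ell[\![T]\!]$. Write $f_{X,\alpha}(T)=(1+T)^{-m}T\,g(T)$ with $m\ge0$ minimal such that $g\in\mathbb{Z}_\ell[T]$, and $g=\ell^\mu P u$ with $P$ distinguished and $u\in\mathbb{Z}_\ell[\![T]\!]^\times$ (Weierstrass preparation); $\mu_\ell(X,\alpha):=\mu$, $\lambda_\ell(X,\alpha):=\deg P$. *)

theory Defs
  imports
    "HOL-Algebra.Elementary_Groups"
    "HOL-Computational_Algebra.Polynomial_FPS"
    "Berlekamp_Zassenhaus.Finite_Field"
    "Jordan_Normal_Form.Determinant"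
    "Graph_Theory.Digraph"
begin

subsection \<open>The ring of \<open>\<ell>\<close>-adic integers\<close>

text \<open>
  The prime \<open>\<ell>\<close> is \<open>CARD('p)\<close> for a type \<open>'p\<close> of prime cardinality, and \<open>'p padic_int\<close> is the
  inverse limit of the rings of integers modulo \<open>\<ell> ^ n\<close>.
\<close>

typedef ('p :: prime_card) padic_int =
  "{x :: nat \<Rightarrow> int. \<forall>n. 0 \<le> x n \<and> x n < int CARD('p) ^ n \<and> x (Suc n) mod int CARD('p) ^ n = x n}"
  morphisms padic_res Abs_padic_int
  using prime_card_int[where 'a = 'p] by (intro exI[of _ "\<lambda>_. 0"]) (auto intro: prime_gt_0_int)

setup_lifting type_definition_padic_int

lemma card_pow_pos: "0 < int CARD('p :: prime_card) ^ n"
  by (simp add: prime_card prime_gt_0_nat)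

lemma mod_card_pow_Suc:
  "a mod int CARD('p :: prime_card) ^ Suc n mod int CARD('p) ^ n = a mod int CARD('p) ^ n"
  by (rule mod_mod_cancel) simp

instantiation padic_int :: (prime_card) comm_ring_1
begin

lift_definition zero_padic_int :: "'a padic_int" is "\<lambda>_. 0"
  by (simp add: prime_card prime_gt_0_nat)

lift_definition one_padic_int :: "'a padic_int" is "\<lambda>n. 1 mod int CARD('a) ^ n"
  using card_pow_pos[where 'p = 'a] mod_card_pow_Suc[where 'p = 'a] by simp

lift_definition plus_padic_int :: "'a padic_int \<Rightarrow> 'a padic_int \<Rightarrow> 'a padic_int"
  is "\<lambda>x y n. (x n + y n) mod int CARD('a) ^ n"
  using card_pow_pos[where 'p = 'a] mod_card_pow_Suc[where 'p = 'a]
  by (metis (no_types, lifting) mod_add_eq pos_mod_bound pos_mod_sign)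

lift_definition uminus_padic_int :: "'a padic_int \<Rightarrow> 'a padic_int"
  is "\<lambda>x n. (- x n) mod int CARD('a) ^ n"
  using card_pow_pos[where 'p = 'a] mod_card_pow_Suc[where 'p = 'a]
  by (metis (no_types, lifting) mod_minus_eq pos_mod_bound pos_mod_sign)

lift_definition minus_padic_int :: "'a padic_int \<Rightarrow> 'a padic_int \<Rightarrow> 'a padic_int"
  is "\<lambda>x y n. (x n - y n) mod int CARD('a) ^ n"
  using card_pow_pos[where 'p = 'a] mod_card_pow_Suc[where 'p = 'a]
  by (metis (no_types, lifting) mod_diff_eq pos_mod_bound pos_mod_sign)

lift_definition times_padic_int :: "'a padic_int \<Rightarrow> 'a padic_int \<Rightarrow> 'a padic_int"
  is "\<lambda>x y n. (x n * y n) mod int CARD('a) ^ n"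
  using card_pow_pos[where 'p = 'a] mod_card_pow_Suc[where 'p = 'a]
  by (metis (no_types, lifting) mod_mult_eq pos_mod_bound pos_mod_sign)

instance
proof
  fix a b c :: "'a padic_int"
  show "a * b * c = a * (b * c)"
    by transfer (auto simp: fun_eq_iff mod_simps algebra_simps)
  show "a * b = b * a"
    by transfer (auto simp: fun_eq_iff mod_simps algebra_simps)
  show "1 * a = a"
    by transfer (auto simp: fun_eq_iff mod_simps)
  show "a + b + c = a + (b + c)"
    by transfer (auto simp: fun_eq_iff mod_simps algebra_simps)
  show "a + b = b + a"
    by transfer (auto simp: fun_eq_iff mod_simps algebra_simps)
  show "0 + a = a"
    by transfer (auto simp: fun_eq_iff mod_simps)
  show "- a + a = 0"
    by transfer (auto simp: fun_eq_iff mod_simps)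
  show "a - b = a + - b"
    by transfer (auto simp: fun_eq_iff mod_simps)
  show "(a + b) * c = a * c + b * c"
    by transfer (auto simp: fun_eq_iff mod_simps algebra_simps)
  have "1 < int CARD('a)"
    using prime_gt_1_nat[OF prime_card[where 'a = 'a]] by simp
  then show "0 \<noteq> (1 :: 'a padic_int)"
    by transfer (auto simp: fun_eq_iff intro!: exI[of _ 1])
qed

end

lemma padic_int_eqI: "(\<And>n. padic_res x n = padic_res y n) \<Longrightarrow> x = y"
  by (simp add: padic_res_inject[symmetric] fun_eq_iff)

lemma padic_res_mod [simp]:
  "padic_res (x :: 'p :: prime_card padic_int) n mod int CARD('p) ^ n = padic_res x n"
  by transfer simp

lemma padic_res_mod_le:
  assumes "m \<le> n"
  shows "padic_res (x :: 'p :: prime_card padic_int) n mod int CARD('p) ^ m = padic_res x m"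
  using assms
proof (induction rule: dec_induct)
  case (step n)
  have "padic_res x (Suc n) mod int CARD('p) ^ m
      = padic_res x (Suc n) mod int CARD('p) ^ n mod int CARD('p) ^ m"
    by (rule mod_mod_cancel[symmetric]) (simp add: le_imp_power_dvd step.hyps)
  also have "padic_res x (Suc n) mod int CARD('p) ^ n = padic_res x n"
    by transfer simp
  finally show ?case using step.IH by simp
qed simp

lemma padic_res_add:
  "padic_res (x + y :: 'p :: prime_card padic_int) n
     = (padic_res x n + padic_res y n) mod int CARD('p) ^ n"
  by transfer simp

lemma padic_res_diff:
  "padic_res (x - y :: 'p :: prime_card padic_int) n
     = (padic_res x n - padic_res y n) mod int CARD('p) ^ n"
  by transfer simp

lemma padic_res_mult:
  "padic_res (x * y :: 'p :: prime_card padic_int) n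
     = (padic_res x n * padic_res y n) mod int CARD('p) ^ n"
  by transfer simp

lemma padic_res_0 [simp]: "padic_res 0 n = 0"
  by transfer simp

lemma padic_res_1: "padic_res (1 :: 'p :: prime_card padic_int) n = 1 mod int CARD('p) ^ n"
  by transfer simp

lemma padic_res_of_nat:
  "padic_res (of_nat k :: 'p :: prime_card padic_int) n = int k mod int CARD('p) ^ n"
  by (induction k) (simp_all add: padic_res_add padic_res_1 mod_simps)

lemma padic_res_of_int:
  "padic_res (of_int k :: 'p :: prime_card padic_int) n = k mod int CARD('p) ^ n"
  by (cases k rule: int_cases2)
     (simp_all add: padic_res_of_nat uminus_padic_int.rep_eq mod_simps)

instance padic_int :: (prime_card) ring_char_0
proof
  show "inj (of_nat :: nat \<Rightarrow> 'a padic_int)"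
  proof (rule injI)
    fix k m :: nat
    assume eq: "(of_nat k :: 'a padic_int) = of_nat m"
    define n where "n = k + m"
    have gt: "n < CARD('a) ^ n"
      using prime_gt_1_nat[OF prime_card[where 'a = 'a]] by (simp add: power_gt_expt)
    have "int k mod int CARD('a) ^ n = int m mod int CARD('a) ^ n"
      using eq by (metis padic_res_of_nat)
    moreover have "int k < int CARD('a) ^ n" "int m < int CARD('a) ^ n"
      using gt unfolding n_def by (simp_all flip: of_nat_power)
    ultimately show "k = m" by simp
  qed
qed

instance padic_int :: (prime_card) idom
proof
  fix x y :: "'a padic_int"
  assume "x \<noteq> 0" "y \<noteq> 0"
  then obtain a b where a: "padic_res x a \<noteq> 0" and b: "padic_res y b \<noteq> 0"
    by (metis padic_int_eqI padic_res_0)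
  let ?l = "int CARD('a)"
  let ?n = "a + b"
  have l: "prime_elem ?l" using prime_card_int[where 'a = 'a] by blast
  have nx: "\<not> ?l ^ a dvd padic_res x ?n" and ny: "\<not> ?l ^ b dvd padic_res y ?n"
    using a b padic_res_mod_le[of a ?n x] padic_res_mod_le[of b ?n y] by (auto simp: dvd_eq_mod_eq_0)
  then have nz: "padic_res x ?n \<noteq> 0" "padic_res y ?n \<noteq> 0" by auto
  have nu: "\<not> is_unit ?l" using prime_gt_1_nat[OF prime_card[where 'a = 'a]] by simp
  have "multiplicity ?l (padic_res x ?n) < a" "multiplicity ?l (padic_res y ?n) < b"
    using nx ny nz nu by (simp_all add: power_dvd_iff_le_multiplicity)
  then have "multiplicity ?l (padic_res x ?n * padic_res y ?n) < ?n"
    using nz l by (simp add: prime_elem_multiplicity_mult_distrib)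
  then have "\<not> ?l ^ ?n dvd padic_res x ?n * padic_res y ?n"
    using nz nu by (simp add: power_dvd_iff_le_multiplicity)
  then have "padic_res (x * y) ?n \<noteq> 0"
    by (simp add: padic_res_mult dvd_eq_mod_eq_0)
  then show "x * y \<noteq> 0" by auto
qed

instantiation padic_int :: (prime_card) idom_divide
begin

text \<open>Exact division; the value is unspecified if \<open>y \<noteq> 0\<close> does not divide \<open>x\<close>.\<close>

definition divide_padic_int :: "'a padic_int \<Rightarrow> 'a padic_int \<Rightarrow> 'a padic_int" where
  "divide_padic_int x y = (if y = 0 then 0 else THE z. z * y = x)"

instance
  by standard (auto simp: divide_padic_int_def)

end

instance padic_int :: (prime_card) algebraic_semidom ..

lemma card_pow_dvd_padic_int_iff:
  "of_nat CARD('p) ^ n dvd (x :: 'p :: prime_card padic_int) \<longleftrightarrow> padic_res x n = 0"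
proof
  assume "of_nat CARD('p) ^ n dvd x"
  then obtain y where "x = of_nat (CARD('p) ^ n) * y" by (auto simp: dvd_def)
  then show "padic_res x n = 0"
    by (simp add: padic_res_mult padic_res_of_nat del: of_nat_power) simp
next
  assume 0: "padic_res x n = 0"
  let ?l = "int CARD('p)"
  have pos: "0 < ?l ^ k" for k by (rule card_pow_pos)
  have dv: "?l ^ n dvd padic_res x (k + n)" for k
    using 0 padic_res_mod_le[of n "k + n" x] by (simp add: dvd_eq_mod_eq_0)
  define y where "y = (\<lambda>k. padic_res x (k + n) div ?l ^ n)"
  have y: "padic_res x (k + n) = ?l ^ n * y k" for k
    using dv by (simp add: y_def)
  have bnd: "0 \<le> padic_res x k \<and> padic_res x k < ?l ^ k" for k
    by transfer simp
  have *: "0 \<le> y k \<and> y k < ?l ^ k \<and> y (Suc k) mod ?l ^ k = y k" for k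
  proof -
    have "0 \<le> ?l ^ n * y k" "?l ^ n * y k < ?l ^ n * ?l ^ k"
      using bnd[of "k + n"] unfolding y by (simp_all add: power_add mult.commute)
    then have "0 \<le> y k" "y k < ?l ^ k"
      using pos[of n] by (auto simp: zero_le_mult_iff)
    moreover have "?l ^ n * (y (Suc k) mod ?l ^ k) = ?l ^ n * y k"
    proof -
      have "?l ^ n * y (Suc k) mod ?l ^ (n + k) = ?l ^ n * y k"
        using padic_res_mod_le[of "k + n" "Suc k + n" x] y[of k] y[of "Suc k"]
        by (simp only: add.commute le_add2 add_Suc_right le_SucI)
      then show ?thesis by (simp only: power_add mult_mod_right)
    qed
    ultimately show ?thesis using pos[of n] by simp
  qed
  then have rep: "padic_res (Abs_padic_int y :: 'p padic_int) = y"
    by (intro Abs_padic_int_inverse) simp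
  have "x = of_nat (CARD('p) ^ n) * Abs_padic_int y"
  proof (rule padic_int_eqI)
    fix k
    have "padic_res (of_nat (CARD('p) ^ n) * Abs_padic_int y :: 'p padic_int) k
        = ?l ^ n * y k mod ?l ^ k"
      by (simp add: padic_res_mult padic_res_of_nat rep mod_simps del: of_nat_power) simp
    also have "\<dots> = padic_res x k"
      using padic_res_mod_le[of k "k + n" x] by (simp add: y)
    finally show "padic_res x k = padic_res (of_nat (CARD('p) ^ n) * Abs_padic_int y :: 'p padic_int) k"
      by (rule sym)
  qed
  then show "of_nat CARD('p) ^ n dvd x" by simp
qed

lemma is_unit_padic_int_of_nat:
  assumes "\<not> CARD('p) dvd k"
  shows "is_unit (of_nat k :: 'p :: prime_card padic_int)"
proof -
  let ?l = "int CARD('p)"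
  have cop: "coprime (int k) (?l ^ n)" for n
    using assms prime_imp_coprime[OF prime_card[where 'a = 'p], of k]
    by (simp add: coprime_commute)
  have "\<exists>y. 0 \<le> y \<and> y < ?l ^ n \<and> int k * y mod ?l ^ n = 1 mod ?l ^ n" for n
  proof -
    obtain z where "[int k * z = 1] (mod ?l ^ n)"
      using cong_solve_coprime_int[OF cop] by blast
    then show ?thesis
      using card_pow_pos[where 'p = 'p, of n]
      by (intro exI[of _ "z mod ?l ^ n"]) (simp add: cong_def mod_simps)
  qed
  then obtain y where y: "0 \<le> y n" "y n < ?l ^ n" "int k * y n mod ?l ^ n = 1 mod ?l ^ n" for n
    by metis
  have "y (Suc n) mod ?l ^ n = y n" for n
  proof -
    have "int k * y (Suc n) mod ?l ^ n = 1 mod ?l ^ n"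
      using y(3)[of "Suc n"] mod_card_pow_Suc[where 'p = 'p] by metis
    then have "[int k * y (Suc n) = int k * y n] (mod ?l ^ n)"
      using y(3)[of n] by (simp add: cong_def)
    then have "[y (Suc n) = y n] (mod ?l ^ n)"
      using cop[of n] by (simp add: cong_mult_lcancel)
    then show ?thesis using y(1,2)[of n] by (simp add: cong_def)
  qed
  then have rep: "padic_res (Abs_padic_int y :: 'p padic_int) = y"
    using y by (intro Abs_padic_int_inverse) simp
  have "of_nat k * Abs_padic_int y = (1 :: 'p padic_int)"
    by (rule padic_int_eqI)
       (simp add: padic_res_mult padic_res_of_nat padic_res_1 rep mod_simps y(3))
  then show ?thesis by (metis dvd_triv_left)
qed

text \<open>
  The definition of \<open>b gchoose k\<close>, which is not available outside fields because of its sort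
  constraint. The division is exact, as \<open>k!\<close> divides the falling factorial of any \<open>\<ell>\<close>-adic integer.
\<close>

definition padic_binomial :: "'p :: prime_card padic_int \<Rightarrow> nat \<Rightarrow> 'p padic_int" where
  "padic_binomial b k = (\<Prod>i = 0..<k. b - of_nat i) div fact k"

lemma fact_times_padic_binomial:
  fixes b :: "'p :: prime_card padic_int"
  shows "fact k * padic_binomial b k = (\<Prod>i = 0..<k. b - of_nat i)"
proof -
  define v where "v = multiplicity CARD('p) (fact k :: nat)"
  obtain w where w: "fact k = CARD('p) ^ v * w" "\<not> CARD('p) dvd w"
    using multiplicity_decompose'[of "fact k :: nat" "CARD('p)"] prime_card[where 'a = 'p]
    unfolding v_def by (metis fact_nonzero not_prime_unit)
  define a where "a = padic_res b v"
  have "padic_res (\<Prod>i\<in>A. b - of_nat i) v = (\<Prod>i\<in>A. a - int i) mod int CARD('p) ^ v"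
    if "finite A" for A
    using that
  proof (induction A rule: finite_induct)
    case (insert i A)
    then show ?case
      by (simp add: padic_res_mult padic_res_diff padic_res_of_nat a_def mod_simps)
  qed (simp add: padic_res_1)
  moreover have "int (CARD('p) ^ v) dvd (\<Prod>i = 0..<k. a - int i)"
  proof -
    have "(fact k :: int) dvd (\<Prod>i = 0..<k. a - int i)"
      by (rule dvdI[OF gbinomial_int_mult_fact[symmetric]])
    moreover have "(fact k :: int) = int (CARD('p) ^ v) * int w"
      by (metis w(1) of_nat_fact of_nat_mult)
    ultimately show ?thesis by (metis dvd_mult_left)
  qed
  ultimately have "of_nat CARD('p) ^ v dvd (\<Prod>i = 0..<k. b - of_nat i)"
    by (simp add: card_pow_dvd_padic_int_iff dvd_eq_mod_eq_0)
  moreover have "is_unit (of_nat w :: 'p padic_int)"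
    using w by (intro is_unit_padic_int_of_nat)
  moreover have "(fact k :: 'p padic_int) = of_nat CARD('p) ^ v * of_nat w"
    using w(1) by (metis of_nat_fact of_nat_mult of_nat_power)
  ultimately have "(fact k :: 'p padic_int) dvd (\<Prod>i = 0..<k. b - of_nat i)"
    by (simp add: mult_unit_dvd_iff)
  then show ?thesis by (simp add: padic_binomial_def)
qed

lemma module_padic_int: "Modules.module ((*) :: 'p :: prime_card padic_int \<Rightarrow> _)"
  by standard (simp_all add: algebra_simps)

definition one_plus_T_pow :: "'p :: prime_card padic_int \<Rightarrow> 'p padic_int fps" where
  "one_plus_T_pow b = Abs_fps (padic_binomial b)"

subsection \<open>Cayley graphs and their Iwasawa polynomials\<close>

definition cayley_graph :: "('g, 'm) monoid_scheme \<Rightarrow> 'g set \<Rightarrow> ('g, 'g \<times> 'g) pre_digraph" where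
  "cayley_graph G S =
     \<lparr>verts = carrier G,
      arcs = {(x, y). x \<in> carrier G \<and> y \<in> carrier G \<and> x \<otimes>\<^bsub>G\<^esub> inv\<^bsub>G\<^esub> y \<in> S},
      tail = fst, head = snd\<rparr>"

definition cayley_voltage :: "('g, 'm) monoid_scheme \<Rightarrow> ('g \<Rightarrow> 'b) \<Rightarrow> 'g \<times> 'g \<Rightarrow> 'b" where
  "cayley_voltage G \<beta> = (\<lambda>(x, y). \<beta> (x \<otimes>\<^bsub>G\<^esub> inv\<^bsub>G\<^esub> y))"

text \<open>Degree matrix minus voltage-weighted adjacency matrix, for an enumeration of the vertices.\<close>

definition iwasawa_matrix ::
  "('v, 'e) pre_digraph \<Rightarrow> ('e \<Rightarrow> 'p :: prime_card padic_int) \<Rightarrow> 'v list \<Rightarrow> 'p padic_int fps mat"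
where
  "iwasawa_matrix X \<alpha> vs = mat (length vs) (length vs) (\<lambda>(i, j).
     (if i = j then of_nat (out_degree X (vs ! i)) else 0)
       - (\<Sum>e | e \<in> arcs X \<and> tail X e = vs ! i \<and> head X e = vs ! j. one_plus_T_pow (\<alpha> e)))"

definition iwasawa_poly ::
  "('v, 'e) pre_digraph \<Rightarrow> ('e \<Rightarrow> 'p :: prime_card padic_int) \<Rightarrow> 'p padic_int fps"
where
  "iwasawa_poly X \<alpha> = det (iwasawa_matrix X \<alpha> (SOME vs. distinct vs \<and> set vs = verts X))"

definition iwasawa_exponent :: "'a :: comm_ring_1 fps \<Rightarrow> nat" where
  "iwasawa_exponent f = (LEAST m. \<exists>g. (1 + fps_X) ^ m * f = fps_X * fps_of_poly g)"

text \<open>The polynomial \<open>g\<close> with \<open>f = (1 + T)\<^sup>-\<^sup>m T g\<close> for the minimal \<open>m\<close>.\<close>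

definition iwasawa_numerator :: "'a :: comm_ring_1 fps \<Rightarrow> 'a poly" where
  "iwasawa_numerator f =
     (THE g. (1 + fps_X) ^ iwasawa_exponent f * f = fps_X * fps_of_poly g)"

definition distinguished :: "'p :: prime_card padic_int poly \<Rightarrow> bool" where
  "distinguished P \<longleftrightarrow> lead_coeff P = 1 \<and> (\<forall>i < degree P. of_nat CARD('p) dvd poly.coeff P i)"

definition weierstrass_factorization ::
  "'p :: prime_card padic_int poly \<Rightarrow> nat \<Rightarrow> 'p padic_int poly \<Rightarrow> 'p padic_int fps \<Rightarrow> bool"
where
  "weierstrass_factorization g m P u \<longleftrightarrow>
     distinguished P \<and> u dvd 1 \<and> fps_of_poly g = of_nat CARD('p) ^ m * fps_of_poly P * u"

definition mu_invariant ::
  "('v, 'e) pre_digraph \<Rightarrow> ('e \<Rightarrow> 'p :: prime_card padic_int) \<Rightarrow> nat"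
where
  "mu_invariant X \<alpha> =
     (THE m. \<exists>P u. weierstrass_factorization (iwasawa_numerator (iwasawa_poly X \<alpha>)) m P u)"

definition lambda_invariant ::
  "('v, 'e) pre_digraph \<Rightarrow> ('e \<Rightarrow> 'p :: prime_card padic_int) \<Rightarrow> nat"
where
  "lambda_invariant X \<alpha> =
     (THE d. \<exists>m P u. weierstrass_factorization (iwasawa_numerator (iwasawa_poly X \<alpha>)) m P u \<and>
                     d = degree P)"

lemma iwasawa_poly_eq:
  assumes "distinct vs" "set vs = verts X"
  shows "iwasawa_poly X \<alpha> = det (iwasawa_matrix X \<alpha> vs)"
proof -
  define ws where "ws = (SOME vs. distinct vs \<and> set vs = verts X)"
  have ws: "distinct ws" "set ws = verts X"
    using someI[of "\<lambda>vs. distinct vs \<and> set vs = verts X" vs] assms unfolding ws_def by auto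
  define n where "n = length vs"
  have n: "length ws = n"
    unfolding n_def using ws assms by (metis distinct_card)
  have "mset vs = mset ws"
    using ws assms by (metis set_eq_iff_mset_eq_distinct)
  then obtain p where p: "p permutes {..<n}" and vs: "permute_list p ws = vs"
    using mset_eq_permutation n by metis
  have p0: "p permutes {0..<n}" using p by (simp add: atLeast0LessThan)
  have pn: "p i < n" if "i < n" for i using p that permutes_in_image by fastforce
  have nth: "vs ! i = ws ! p i" if "i < n" for i
    using that vs p n by (metis permute_list_nth)
  have inj: "p i = p j \<longleftrightarrow> i = j" for i j
    using p by (metis permutes_inverses(2))
  let ?A = "iwasawa_matrix X \<alpha> ws"
  let ?B = "mat n n (\<lambda>(i, j). ?A $$ (p i, j))"
  have A: "?A \<in> carrier_mat n n" by (simp add: iwasawa_matrix_def n)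
  have "iwasawa_matrix X \<alpha> vs = transpose_mat (mat n n (\<lambda>(i, j). transpose_mat ?B $$ (p i, j)))"
    by (rule eq_matI) (auto simp: iwasawa_matrix_def n n_def[symmetric] nth pn inj)
  also have "det \<dots> = det (mat n n (\<lambda>(i, j). transpose_mat ?B $$ (p i, j)))"
    by (rule det_transpose[of _ n]) simp
  also have "\<dots> = signof p * det (transpose_mat ?B)"
    by (rule det_permute_rows[OF _ p0]) simp
  also have "det (transpose_mat ?B) = det ?B"
    by (rule det_transpose[of _ n]) simp
  also have "det ?B = signof p * det ?A"
    by (rule det_permute_rows[OF A p0])
  also have "signof p * (signof p * det ?A) = det ?A"
    by (simp add: sign_def)
  finally show ?thesis by (simp add: iwasawa_poly_def ws_def)
qed

text \<open>
  For the Cayley graph this is the matrix with entries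
  \<open>r \<delta>\<^sub>i\<^sub>j - \<delta>\<^sub>S(g\<^sub>i g\<^sub>j\<^sup>-\<^sup>1) (1 + T) ^ \<beta>(g\<^sub>i g\<^sub>j\<^sup>-\<^sup>1)\<close>, where \<open>r\<close> is the cardinality of \<open>S\<close>.
\<close>

lemma iwasawa_matrix_cayley:
  assumes "group G" "S \<subseteq> carrier G" "set gs = carrier G"
  shows "iwasawa_matrix (cayley_graph G S) (cayley_voltage G \<beta>) gs =
    mat (length gs) (length gs) (\<lambda>(i, j).
      of_nat (card S) * (if i = j then 1 else 0)
        - (if gs ! i \<otimes>\<^bsub>G\<^esub> inv\<^bsub>G\<^esub> (gs ! j) \<in> S then 1 else 0)
            * one_plus_T_pow (\<beta> (gs ! i \<otimes>\<^bsub>G\<^esub> inv\<^bsub>G\<^esub> (gs ! j))))"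
proof -
  interpret group G by fact
  have deg: "out_degree (cayley_graph G S) x = card S" if x: "x \<in> carrier G" for x
  proof -
    have s: "x \<otimes>\<^bsub>G\<^esub> inv\<^bsub>G\<^esub> (inv\<^bsub>G\<^esub> s \<otimes>\<^bsub>G\<^esub> x) = s" if "s \<in> S" for s
    proof -
      have sG: "s \<in> carrier G" using that assms(2) by blast
      then have "x \<otimes>\<^bsub>G\<^esub> inv\<^bsub>G\<^esub> (inv\<^bsub>G\<^esub> s \<otimes>\<^bsub>G\<^esub> x) = x \<otimes>\<^bsub>G\<^esub> (inv\<^bsub>G\<^esub> x \<otimes>\<^bsub>G\<^esub> s)"
        using x by (simp add: inv_mult_group)
      also have "\<dots> = s"
        using x sG m_assoc[of x "inv\<^bsub>G\<^esub> x" s] by simp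
      finally show ?thesis .
    qed
    have y: "inv\<^bsub>G\<^esub> (x \<otimes>\<^bsub>G\<^esub> inv\<^bsub>G\<^esub> y) \<otimes>\<^bsub>G\<^esub> x = y" if "y \<in> carrier G" for y
      using that x by (simp add: inv_mult_group m_assoc)
    have "bij_betw (\<lambda>e. x \<otimes>\<^bsub>G\<^esub> inv\<^bsub>G\<^esub> (snd e)) (out_arcs (cayley_graph G S) x) S"
    proof (rule bij_betw_byWitness[where f' = "\<lambda>s. (x, inv\<^bsub>G\<^esub> s \<otimes>\<^bsub>G\<^esub> x)"])
      show "(\<lambda>s. (x, inv\<^bsub>G\<^esub> s \<otimes>\<^bsub>G\<^esub> x)) ` S \<subseteq> out_arcs (cayley_graph G S) x"
        using x assms(2) s by (auto simp: cayley_graph_def in_out_arcs_conv)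
    qed (use s y in \<open>auto simp: cayley_graph_def in_out_arcs_conv\<close>)
    then show ?thesis unfolding out_degree_def by (rule bij_betw_same_card)
  qed
  have arcs: "{e. e \<in> arcs (cayley_graph G S) \<and> tail (cayley_graph G S) e = x
                \<and> head (cayley_graph G S) e = y} = (if x \<otimes>\<^bsub>G\<^esub> inv\<^bsub>G\<^esub> y \<in> S then {(x, y)} else {})"
    if "x \<in> carrier G" "y \<in> carrier G" for x y
    using that by (auto simp: cayley_graph_def)
  have "gs ! i \<in> carrier G" if "i < length gs" for i
    using that assms(3) nth_mem by blast
  then show ?thesis
    unfolding iwasawa_matrix_def
    by (intro cong_mat) (auto simp: deg arcs cayley_voltage_def)
qed

end

theory Submission
  imports Defs
begin

text \<open>
  All rows of the Iwasawa matrix of a Cayley graph have the same sum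
  \<open>c = \<Sum>\<^sub>s (1 - (1 + T)\<^bsup>\<beta>(s)\<^esup>)\<close>. By Cramer's rule \<open>f\<close> is \<open>c\<close> times the determinant \<open>d\<close> of the
  matrix with one column replaced by ones; for the complete graph \<open>d\<close> has constant term \<open>n\<^bsup>n-1\<^esup>\<close>,
  an \<open>\<ell>\<close>-adic unit. As \<open>\<beta>\<close> is odd, \<open>\<Sum>\<^sub>s \<beta>(s) = 0\<close>, so \<open>c\<close> starts with \<open>- Q T\<^sup>2\<close> where
  \<open>2 Q = \<Sum>\<^sub>s \<beta>(s)\<^sup>2\<close> is a unit. Thus \<open>f\<close> is \<open>T\<^sup>2\<close> times a unit power series, and \<open>g\<close> is \<open>T\<close> times
  a unit.
\<close>

section \<open>Determinants with a replaced column\<close>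

lemma det_replace_col:
  fixes A :: "'a :: comm_ring_1 mat"
  assumes A: "A \<in> carrier_mat n n" and k: "k < n"
  shows "det (replace_col A b k) = (\<Sum>i<n. b $ i * cofactor A i k)"
proof -
  have B: "replace_col A b k \<in> carrier_mat n n"
    using A by (simp add: replace_col_def)
  have "mat_delete (replace_col A b k) i k = mat_delete A i k" for i
    by (rule eq_matI) (auto simp: mat_delete_def replace_col_def)
  then show ?thesis
    using A k unfolding laplace_expansion_column[OF B k] cofactor_def
    by (intro sum.cong) (simp_all add: replace_col_def)
qed

lemma det_eq_eigenvalue_times_det_replace_col:
  fixes A :: "'a :: comm_ring_1 mat"
  assumes A: "A \<in> carrier_mat n n" and x: "x \<in> carrier_vec n" and k: "k < n"
    and eigen: "A *\<^sub>v x = c \<cdot>\<^sub>v x"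
  shows "x $ k * det A = c * det (replace_col A x k)"
proof -
  have "x $ k * det A = det (replace_col A (c \<cdot>\<^sub>v x) k)"
    using cramer_lemma_mat[OF A x k] by (simp add: eigen)
  also have "\<dots> = c * det (replace_col A x k)"
    using x by (simp add: det_replace_col[OF A k] sum_distrib_left mult.assoc)
  finally show ?thesis .
qed

lemma det_replace_col_rank_one_update:
  fixes a :: "'a :: comm_ring_1"
  assumes n: "0 < n" and u: "u \<in> carrier_vec n"
  shows "det (replace_col (mat n n (\<lambda>(i, j). (if i = j then a else 0) + u $ i * w j)) u 0)
    = u $ 0 * a ^ (n - 1)"
    (is "det ?B = _")
proof -
  define U where "U = replace_col (1\<^sub>m n) u 0"
  define E where "E = mat n n (\<lambda>(i, j). if i = 0 then if j = 0 then 1 else w j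
    else if i = j then a else 0)"
  have U: "U \<in> carrier_mat n n" and E: "E \<in> carrier_mat n n"
    by (simp_all add: U_def E_def replace_col_def)
  have "?B = U * E"
  proof (rule eq_matI)
    fix i j assume "i < dim_row (U * E)" "j < dim_col (U * E)"
    then have ij: "i < n" "j < n" using U E by auto
    have "(U * E) $$ (i, j) = (\<Sum>k = 0..<n. U $$ (i, k) * E $$ (k, j))"
      using ij U E by (simp add: scalar_prod_def)
    also have "\<dots> = (\<Sum>k = 0..<n. (if k = 0 then u $ i * E $$ (0, j) else 0)
        + (if k = i then if i = 0 then 0 else E $$ (i, j) else 0))"
      using ij by (intro sum.cong) (auto simp: U_def replace_col_def)
    also have "\<dots> = ?B $$ (i, j)"
      using ij n by (auto simp: sum.distrib E_def replace_col_def)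
    finally show "?B $$ (i, j) = (U * E) $$ (i, j)" by (rule sym)
  qed (use U E in \<open>auto simp: replace_col_def\<close>)
  moreover have "det U = u $ 0"
    using cramer_lemma_mat[of "1\<^sub>m n" n u 0] u n by (simp add: U_def)
  moreover have "diag_mat E = 1 # replicate (n - 1) a"
    using n by (intro nth_equalityI) (auto simp: E_def diag_mat_def nth_Cons')
  then have "det E = a ^ (n - 1)"
    by (subst det_upper_triangular[OF _ E]) (auto simp: E_def)
  ultimately show ?thesis
    using det_mult[OF U E] by simp
qed

section \<open>Units\<close>

lemma fps_is_unit_iff: "f dvd 1 \<longleftrightarrow> fps_nth f 0 dvd 1" for f :: "'a :: comm_ring_1 fps"
  using fps_is_left_unit_iff_zeroth_is_left_unit[of f] by (simp add: dvd_def)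

lemma not_is_unit_padic_card: "\<not> (of_nat CARD('p) :: 'p :: prime_card padic_int) dvd 1"
proof -
  have "1 < int CARD('p)"
    using prime_gt_1_nat[OF prime_card[where 'a = 'p]] by simp
  then show ?thesis
    using card_pow_dvd_padic_int_iff[of 1 "1 :: 'p padic_int"] by (simp add: padic_res_1)
qed

lemma padic_int_inverse_mod_power:
  fixes x :: "'p :: prime_card padic_int"
  assumes "\<not> of_nat CARD('p) dvd x"
  obtains y where "0 \<le> y" "y < int CARD('p) ^ n" "[padic_res x n * y = 1] (mod int CARD('p) ^ n)"
proof -
  have "coprime (padic_res x n) (int CARD('p) ^ n)"
  proof (cases "n = 0")
    case False
    then have "padic_res x n mod int CARD('p) = padic_res x 1"
      using padic_res_mod_le[of 1 n x] by simp
    moreover have "padic_res x 1 \<noteq> 0"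
      using assms card_pow_dvd_padic_int_iff[of 1 x] by simp
    ultimately have "\<not> int CARD('p) dvd padic_res x n"
      by (simp add: dvd_eq_mod_eq_0)
    then have "coprime (int CARD('p)) (padic_res x n)"
      using prime_card_int[where 'a = 'p] by (simp add: prime_imp_coprime)
    then show ?thesis by (simp add: coprime_commute)
  qed simp
  then obtain z where "[padic_res x n * z = 1] (mod int CARD('p) ^ n)"
    using cong_solve_coprime_int by blast
  then show ?thesis
    using card_pow_pos[where 'p = 'p, of n]
    by (intro that[of "z mod int CARD('p) ^ n"]) (simp_all add: cong_def mod_simps)
qed

lemma padic_int_is_unit_iff:
  fixes x :: "'p :: prime_card padic_int"
  shows "x dvd 1 \<longleftrightarrow> \<not> of_nat CARD('p) dvd x"
proof
  assume "x dvd 1"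
  then show "\<not> of_nat CARD('p) dvd x"
    using not_is_unit_padic_card dvd_trans by blast
next
  let ?l = "int CARD('p)"
  assume "\<not> of_nat CARD('p) dvd x"
  then have "\<exists>y. 0 \<le> y \<and> y < ?l ^ n \<and> [padic_res x n * y = 1] (mod ?l ^ n)" for n
    by (metis padic_int_inverse_mod_power)
  then obtain y where bounds: "0 \<le> y n" "y n < ?l ^ n"
    and inverse: "[padic_res x n * y n = 1] (mod ?l ^ n)" for n
    by metis
  have "y (Suc n) mod ?l ^ n = y n" for n
  proof -
    have "[padic_res x n = padic_res x (Suc n)] (mod ?l ^ n)"
      using padic_res_mod_le[of n "Suc n" x] by (simp add: cong_def)
    then have "[padic_res x n * y (Suc n) = padic_res x (Suc n) * y (Suc n)] (mod ?l ^ n)"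
      by (rule cong_scalar_right)
    also have "[padic_res x (Suc n) * y (Suc n) = 1] (mod ?l ^ n)"
      using inverse by (rule cong_dvd_modulus) simp
    finally have "[y n * (padic_res x n * y (Suc n)) = y n * 1] (mod ?l ^ n)"
      by (rule cong_scalar_left)
    moreover have "[padic_res x n * y n * y (Suc n) = 1 * y (Suc n)] (mod ?l ^ n)"
      using inverse by (rule cong_scalar_right)
    ultimately have "[y (Suc n) = y n] (mod ?l ^ n)"
      by (simp add: ac_simps cong_def)
    then show ?thesis
      using bounds[of n] by (simp add: cong_def)
  qed
  then have res: "padic_res (Abs_padic_int y :: 'p padic_int) = y"
    using bounds by (intro Abs_padic_int_inverse) simp
  have "x * Abs_padic_int y = 1"
    using inverse by (intro padic_int_eqI) (simp add: padic_res_mult padic_res_1 res cong_def)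
  then show "x dvd 1" by (metis dvd_triv_left)
qed

section \<open>Binomial series with \<open>\<ell>\<close>-adic exponents\<close>

lemma fact_times_padic_binomial_pochhammer:
  "fact k * padic_binomial b k = (- 1) ^ k * pochhammer (- b) k"
  for b :: "'p :: prime_card padic_int"
proof -
  have "(\<Prod>i = 0..<k. b - of_nat i) = (\<Prod>i = 0..<k. - 1 * (- b + of_nat i))"
    by simp
  then show ?thesis
    unfolding fact_times_padic_binomial prod.distrib pochhammer_prod by simp
qed

lemma padic_binomial_0 [simp]: "padic_binomial b 0 = 1" for b :: "'p :: prime_card padic_int"
  using fact_times_padic_binomial[of 0 b] by simp

lemma padic_binomial_1 [simp]: "padic_binomial b (Suc 0) = b" for b :: "'p :: prime_card padic_int"
  using fact_times_padic_binomial[of "Suc 0" b] by simp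

lemma two_times_padic_binomial_2:
  "2 * padic_binomial b 2 = b ^ 2 - b" for b :: "'p :: prime_card padic_int"
  using fact_times_padic_binomial[of 2 b] by (simp add: numeral_2_eq_2 algebra_simps)

lemma padic_binomial_Vandermonde:
  fixes a b :: "'p :: prime_card padic_int"
  shows "padic_binomial (a + b) n = (\<Sum>k\<le>n. padic_binomial a k * padic_binomial b (n - k))"
proof -
  have term_eq: "(- 1) ^ n * (of_nat (n choose k) * pochhammer (- a) k * pochhammer (- b) (n - k))
      = fact n * (padic_binomial a k * padic_binomial b (n - k))" if "k \<le> n" for k
  proof -
    have sign: "(- 1) ^ n = (- 1) ^ k * (- 1 :: 'p padic_int) ^ (n - k)"
      using that by (simp flip: power_add)
    have "(fact n :: 'p padic_int) = of_nat (fact k * fact (n - k) * (n choose k))"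
      by (simp only: binomial_fact_lemma[OF that] of_nat_fact)
    then have "fact n = fact k * fact (n - k) * (of_nat (n choose k) :: 'p padic_int)"
      by simp
    then have "fact n * (padic_binomial a k * padic_binomial b (n - k))
        = of_nat (n choose k) * (fact k * padic_binomial a k)
            * (fact (n - k) * padic_binomial b (n - k))"
      by (simp only: ac_simps)
    then show ?thesis
      by (simp only: fact_times_padic_binomial_pochhammer sign ac_simps)
  qed
  have "fact n * padic_binomial (a + b) n = (- 1) ^ n * pochhammer (- a + - b) n"
    by (simp add: fact_times_padic_binomial_pochhammer)
  also have "\<dots> = fact n * (\<Sum>k\<le>n. padic_binomial a k * padic_binomial b (n - k))"
    unfolding pochhammer_binomial_sum sum_distrib_left by (intro sum.cong refl term_eq) simp
  finally show ?thesis
    using mult_left_cancel[OF fact_nonzero[of n, where 'a = "'p padic_int"]] by blast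
qed

lemma one_plus_T_pow_add:
  "one_plus_T_pow (a + b) = one_plus_T_pow a * one_plus_T_pow b"
  for a b :: "'p :: prime_card padic_int"
  by (rule fps_ext)
     (simp add: one_plus_T_pow_def fps_mult_nth padic_binomial_Vandermonde atLeast0AtMost)

lemma one_plus_T_pow_of_nat:
  "one_plus_T_pow (of_nat m :: 'p :: prime_card padic_int) = (1 + fps_X) ^ m"
proof (induction m)
  case 0
  have "fact k * padic_binomial 0 k = fact k * (if k = 0 then 1 else (0 :: 'p padic_int))" for k
    unfolding fact_times_padic_binomial by (auto intro!: bexI[of _ 0])
  then show ?case by (intro fps_ext) (simp add: one_plus_T_pow_def)
next
  case (Suc m)
  have "fact k * padic_binomial 1 k = fact k * (if k \<le> 1 then 1 else (0 :: 'p padic_int))" for k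
    unfolding fact_times_padic_binomial by (auto simp: le_Suc_eq intro!: bexI[of _ 1])
  then have "one_plus_T_pow (1 :: 'p padic_int) = 1 + fps_X"
    by (intro fps_ext) (auto simp: one_plus_T_pow_def fps_X_def)
  then show ?case by (simp add: one_plus_T_pow_add Suc.IH)
qed

section \<open>Laurent polynomials in \<open>1 + T\<close>\<close>

definition laurent_in_one_plus_X :: "'a :: comm_ring_1 fps \<Rightarrow> bool" where
  "laurent_in_one_plus_X f \<longleftrightarrow> (\<exists>k q. (1 + fps_X) ^ k * f = fps_of_poly q)"

lemma fps_of_poly_one_plus_X_power: "fps_of_poly ([:1, 1:] ^ k) = (1 + fps_X) ^ k"
  by (simp add: fps_of_poly_power fps_of_poly_pCons)

lemma laurent_in_one_plus_X_of_nat: "laurent_in_one_plus_X (of_nat k)"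
  unfolding laurent_in_one_plus_X_def
  by (rule exI[of _ 0], rule exI[of _ "of_nat k"])
     (simp add: of_nat_poly fps_of_poly_const fps_of_nat)

lemma laurent_in_one_plus_X_mult:
  assumes "laurent_in_one_plus_X f" "laurent_in_one_plus_X g"
  shows "laurent_in_one_plus_X (f * g)"
proof -
  obtain k p l q where p: "(1 + fps_X) ^ k * f = fps_of_poly p"
    and q: "(1 + fps_X) ^ l * g = fps_of_poly q"
    using assms unfolding laurent_in_one_plus_X_def by blast
  have "(1 + fps_X) ^ (k + l) * (f * g) = fps_of_poly (p * q)"
    by (simp add: fps_of_poly_mult power_add ac_simps flip: p q)
  then show ?thesis unfolding laurent_in_one_plus_X_def by blast
qed

lemma laurent_in_one_plus_X_diff:
  assumes "laurent_in_one_plus_X f" "laurent_in_one_plus_X g"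
  shows "laurent_in_one_plus_X (f - g)"
proof -
  obtain k p l q where p: "(1 + fps_X) ^ k * f = fps_of_poly p"
    and q: "(1 + fps_X) ^ l * g = fps_of_poly q"
    using assms unfolding laurent_in_one_plus_X_def by blast
  have "(1 + fps_X) ^ (k + l) * (f - g) = fps_of_poly ([:1, 1:] ^ l * p - [:1, 1:] ^ k * q)"
    unfolding fps_of_poly_diff fps_of_poly_mult fps_of_poly_one_plus_X_power
    by (simp add: power_add algebra_simps flip: p q)
  then show ?thesis unfolding laurent_in_one_plus_X_def by blast
qed

lemma laurent_in_one_plus_X_add:
  assumes "laurent_in_one_plus_X f" "laurent_in_one_plus_X g"
  shows "laurent_in_one_plus_X (f + g)"
  using laurent_in_one_plus_X_diff[OF assms(1) laurent_in_one_plus_X_diff[OF _ assms(2), of 0]]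
    laurent_in_one_plus_X_of_nat[of 0] by simp

lemma laurent_in_one_plus_X_sum:
  "(\<And>i. i \<in> I \<Longrightarrow> laurent_in_one_plus_X (f i)) \<Longrightarrow> laurent_in_one_plus_X (\<Sum>i\<in>I. f i)"
  using laurent_in_one_plus_X_of_nat[of 0]
  by (induction I rule: infinite_finite_induct) (auto intro: laurent_in_one_plus_X_add)

lemma laurent_in_one_plus_X_prod:
  "(\<And>i. i \<in> I \<Longrightarrow> laurent_in_one_plus_X (f i)) \<Longrightarrow> laurent_in_one_plus_X (\<Prod>i\<in>I. f i)"
  using laurent_in_one_plus_X_of_nat[of 1]
  by (induction I rule: infinite_finite_induct) (auto intro: laurent_in_one_plus_X_mult)

lemma laurent_in_one_plus_X_det:
  fixes A :: "'a :: comm_ring_1 fps mat"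
  assumes A: "A \<in> carrier_mat n n"
    and entries: "\<And>i j. i < n \<Longrightarrow> j < n \<Longrightarrow> laurent_in_one_plus_X (A $$ (i, j))"
  shows "laurent_in_one_plus_X (det A)"
  unfolding det_def'[OF A]
proof (rule laurent_in_one_plus_X_sum)
  fix p assume p: "p \<in> {p. p permutes {0..<n}}"
  have "laurent_in_one_plus_X (\<Prod>i = 0..<n. A $$ (i, p i))"
    using p by (intro laurent_in_one_plus_X_prod entries) (auto dest: permutes_in_image)
  moreover have "signof p = (1 :: 'a fps) \<or> signof p = (0 - 1 :: 'a fps)"
    by (simp add: sign_def)
  then have "laurent_in_one_plus_X (signof p :: 'a fps)"
    using laurent_in_one_plus_X_of_nat[of 0] laurent_in_one_plus_X_of_nat[of 1]
      laurent_in_one_plus_X_diff[of 0 1] by fastforce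
  ultimately show "laurent_in_one_plus_X (signof p * (\<Prod>i = 0..<n. A $$ (i, p i)))"
    by (rule laurent_in_one_plus_X_mult[rotated])
qed

lemma laurent_in_one_plus_X_one_plus_T_pow:
  fixes b :: "'p :: prime_card padic_int"
  assumes "b \<in> \<int>"
  shows "laurent_in_one_plus_X (one_plus_T_pow b)"
proof -
  obtain z where b: "b = of_int z" using assms by (rule Ints_cases)
  have "of_nat (nat (- z)) + b = of_nat (nat z)"
    by (cases "z \<ge> 0") (simp_all add: b)
  then have "(1 + fps_X) ^ nat (- z) * one_plus_T_pow b = fps_of_poly ([:1, 1:] ^ nat z)"
    unfolding fps_of_poly_one_plus_X_power by (metis one_plus_T_pow_add one_plus_T_pow_of_nat)
  then show ?thesis unfolding laurent_in_one_plus_X_def by blast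
qed

lemma iwasawa_matrix_carrier: "iwasawa_matrix X \<alpha> vs \<in> carrier_mat (length vs) (length vs)"
  by (simp add: iwasawa_matrix_def)

lemma laurent_in_one_plus_X_iwasawa_poly:
  assumes "\<alpha> ` arcs X \<subseteq> \<int>"
  shows "laurent_in_one_plus_X (iwasawa_poly X \<alpha>)"
proof -
  have "laurent_in_one_plus_X (iwasawa_matrix X \<alpha> vs $$ (i, j))"
    if ij: "i < length vs" "j < length vs" for vs i j
  proof -
    have "iwasawa_matrix X \<alpha> vs $$ (i, j) = of_nat (if i = j then out_degree X (vs ! i) else 0)
        - (\<Sum>e | e \<in> arcs X \<and> tail X e = vs ! i \<and> head X e = vs ! j. one_plus_T_pow (\<alpha> e))"
      using ij by (simp add: iwasawa_matrix_def)
    also have "laurent_in_one_plus_X \<dots>"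
      using assms
      by (intro laurent_in_one_plus_X_diff laurent_in_one_plus_X_of_nat laurent_in_one_plus_X_sum
        laurent_in_one_plus_X_one_plus_T_pow) auto
    finally show ?thesis .
  qed
  then show ?thesis
    unfolding iwasawa_poly_def by (intro laurent_in_one_plus_X_det[OF iwasawa_matrix_carrier])
qed

section \<open>Weierstrass factorizations and Iwasawa invariants\<close>

text \<open>
  The exponent \<open>m\<close> is the minimal \<open>\<ell>\<close>-adic valuation of a coefficient, and the degree of \<open>P\<close> is the
  first index where it is attained.
\<close>

lemma weierstrass_factorization_coeff:
  fixes g :: "'p :: prime_card padic_int poly"
  assumes "weierstrass_factorization g m P u"
  shows "of_nat CARD('p) ^ m dvd poly.coeff g i"
    and "i < degree P \<Longrightarrow> of_nat CARD('p) ^ Suc m dvd poly.coeff g i"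
    and "\<not> of_nat CARD('p) ^ Suc m dvd poly.coeff g (degree P)"
proof -
  let ?l = "of_nat CARD('p) :: 'p padic_int"
  define h where "h = fps_of_poly P * u"
  have lead: "lead_coeff P = 1" and low: "\<And>j. j < degree P \<Longrightarrow> ?l dvd poly.coeff P j"
    and unit: "fps_nth u 0 dvd 1" and g: "fps_of_poly g = of_nat CARD('p) ^ m * h"
    using assms
    by (auto simp: weierstrass_factorization_def distinguished_def fps_is_unit_iff h_def mult.assoc)
  have "(of_nat CARD('p) :: 'p padic_int fps) ^ m = fps_const (?l ^ m)"
    by (simp add: fps_of_nat flip: fps_const_power)
  then have coeff_g: "poly.coeff g i = ?l ^ m * fps_nth h i" for i
    by (simp add: g flip: fps_of_poly_nth)
  then show "?l ^ m dvd poly.coeff g i" by simp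
  have Suc_dvd_iff: "?l ^ Suc m dvd poly.coeff g i \<longleftrightarrow> ?l dvd fps_nth h i" for i
    by (simp add: coeff_g)
  have coeff_h: "fps_nth h i = (\<Sum>j\<in>{..i}. poly.coeff P j * fps_nth u (i - j))" for i
    by (simp add: h_def fps_mult_nth atLeast0AtMost)
  show "?l ^ Suc m dvd poly.coeff g i" if "i < degree P"
    using that unfolding Suc_dvd_iff coeff_h by (intro dvd_sum dvd_mult2 low) simp
  have "fps_nth h (degree P)
      = fps_nth u 0 + (\<Sum>j\<in>{..<degree P}. poly.coeff P j * fps_nth u (degree P - j))"
    unfolding coeff_h by (simp add: lead flip: lessThan_Suc_atMost)
  moreover have "?l dvd (\<Sum>j\<in>{..<degree P}. poly.coeff P j * fps_nth u (degree P - j))"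
    by (intro dvd_sum dvd_mult2 low) simp
  moreover have "\<not> ?l dvd fps_nth u 0"
    using unit by (simp add: padic_int_is_unit_iff)
  ultimately show "\<not> ?l ^ Suc m dvd poly.coeff g (degree P)"
    unfolding Suc_dvd_iff by (simp add: dvd_add_left_iff)
qed

lemma weierstrass_factorization_le:
  assumes W: "weierstrass_factorization g m P u" and W': "weierstrass_factorization g m' P' u'"
  shows "m \<le> m'" and "m = m' \<Longrightarrow> degree P \<le> degree P'"
proof -
  note coeff = weierstrass_factorization_coeff[OF W]
    and coeff' = weierstrass_factorization_coeff[OF W']
  show "m \<le> m'"
    using coeff(1) coeff'(3) power_le_dvd[of _ m _ "Suc m'"] not_less_eq_eq by blast
  show "m = m' \<Longrightarrow> degree P \<le> degree P'"
    using coeff(2) coeff'(3) not_le by blast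
qed

lemma weierstrass_factorization_unique:
  assumes "weierstrass_factorization g m P u" "weierstrass_factorization g m' P' u'"
  shows "m = m'" and "degree P = degree P'"
  using weierstrass_factorization_le[OF assms] weierstrass_factorization_le[OF assms(2,1)]
  by simp_all

lemma mu_invariant_eqI:
  assumes "weierstrass_factorization (iwasawa_numerator (iwasawa_poly X \<alpha>)) m P u"
  shows "mu_invariant X \<alpha> = m"
  unfolding mu_invariant_def
  using assms weierstrass_factorization_unique(1)[OF assms] by (intro the_equality) blast+

lemma lambda_invariant_eqI:
  assumes "weierstrass_factorization (iwasawa_numerator (iwasawa_poly X \<alpha>)) m P u"
  shows "lambda_invariant X \<alpha> = degree P"
  unfolding lambda_invariant_def
proof (rule the_equality)
  show "\<exists>m P' u. weierstrass_factorization (iwasawa_numerator (iwasawa_poly X \<alpha>)) m P' u \<and>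
      degree P = degree P'"
    using assms by blast
qed (auto dest: weierstrass_factorization_unique(2)[OF assms])

lemma fps_X_times_iwasawa_numerator:
  fixes f :: "'a :: idom fps"
  assumes laurent: "laurent_in_one_plus_X f" and f0: "fps_nth f 0 = 0"
  shows "fps_X * fps_of_poly (iwasawa_numerator f) = (1 + fps_X) ^ iwasawa_exponent f * f"
proof -
  obtain k q where q: "(1 + fps_X) ^ k * f = fps_of_poly q"
    using laurent unfolding laurent_in_one_plus_X_def by blast
  obtain a r where r: "q = pCons a r" by (cases q)
  have "a = fps_nth ((1 + fps_X) ^ k * f) 0"
    by (simp add: q r)
  then have "a = 0"
    by (simp add: f0)
  then have "(1 + fps_X) ^ k * f = fps_X * fps_of_poly r"
    unfolding q r by (simp add: fps_of_poly_pCons mult.commute)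
  then have "\<exists>g. (1 + fps_X) ^ iwasawa_exponent f * f = fps_X * fps_of_poly g"
    unfolding iwasawa_exponent_def
    by (intro LeastI[of "\<lambda>m. \<exists>g. (1 + fps_X) ^ m * f = fps_X * fps_of_poly g" k] exI)
  then obtain g where g: "(1 + fps_X) ^ iwasawa_exponent f * f = fps_X * fps_of_poly g"
    by blast
  then have "iwasawa_numerator f = g"
    unfolding iwasawa_numerator_def by (intro the_equality) (auto simp: fps_of_poly_eq_iff)
  with g show ?thesis by simp
qed

lemma mu_lambda_invariant_eqI:
  fixes \<alpha> :: "'e \<Rightarrow> 'p :: prime_card padic_int"
  assumes "\<alpha> ` arcs X \<subseteq> \<int>" and P: "distinguished P" and u: "u dvd 1"
    and f: "iwasawa_poly X \<alpha> = fps_X * (of_nat CARD('p) ^ m * fps_of_poly P * u)"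
  shows "mu_invariant X \<alpha> = m" and "lambda_invariant X \<alpha> = degree P"
proof -
  let ?v = "(1 + fps_X) ^ iwasawa_exponent (iwasawa_poly X \<alpha>) * u"
  have "fps_X * fps_of_poly (iwasawa_numerator (iwasawa_poly X \<alpha>))
      = (1 + fps_X) ^ iwasawa_exponent (iwasawa_poly X \<alpha>) * iwasawa_poly X \<alpha>"
    using assms(1) f
    by (intro fps_X_times_iwasawa_numerator laurent_in_one_plus_X_iwasawa_poly) simp_all
  also have "\<dots> = fps_X * (of_nat CARD('p) ^ m * fps_of_poly P * ?v)"
    by (subst (2) f) (simp only: ac_simps)
  finally have "fps_of_poly (iwasawa_numerator (iwasawa_poly X \<alpha>))
      = of_nat CARD('p) ^ m * fps_of_poly P * ?v"
    using mult_left_cancel[OF fps_X_neq_zero] by blast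
  moreover have "?v dvd 1"
    using u by (simp add: fps_is_unit_iff fps_power_zeroth)
  ultimately have "weierstrass_factorization (iwasawa_numerator (iwasawa_poly X \<alpha>)) m P ?v"
    using P by (simp add: weierstrass_factorization_def)
  then show "mu_invariant X \<alpha> = m" and "lambda_invariant X \<alpha> = degree P"
    by (rule mu_invariant_eqI lambda_invariant_eqI)+
qed

section \<open>Cayley graphs\<close>

lemma cayley_voltage_arcs_subset:
  "cayley_voltage G \<beta> ` arcs (cayley_graph G S) \<subseteq> \<beta> ` S"
  by (auto simp: cayley_voltage_def cayley_graph_def)

text \<open>The eigenvalue of the Iwasawa matrix on constant vectors.\<close>

definition cayley_eigenvalue ::
  "'g set \<Rightarrow> ('g \<Rightarrow> 'p :: prime_card padic_int) \<Rightarrow> 'p padic_int fps"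
where
  "cayley_eigenvalue S \<beta> = (\<Sum>s\<in>S. 1 - one_plus_T_pow (\<beta> s))"

lemma cayley_eigenvalue_nth:
  "fps_nth (cayley_eigenvalue S \<beta>) 0 = 0"
  "fps_nth (cayley_eigenvalue S \<beta>) (Suc 0) = - (\<Sum>s\<in>S. \<beta> s)"
  "2 * fps_nth (cayley_eigenvalue S \<beta>) 2 = (\<Sum>s\<in>S. \<beta> s) - (\<Sum>s\<in>S. \<beta> s ^ 2)"
  by (simp_all add: cayley_eigenvalue_def one_plus_T_pow_def fps_sum_nth sum_negf
      sum_distrib_left two_times_padic_binomial_2 sum_subtractf)

context group
begin

lemma sum_odd_eq_0:
  fixes F :: "'a \<Rightarrow> 'c :: {idom, ring_char_0}"
  assumes "S \<subseteq> carrier G" and closed: "\<And>s. s \<in> S \<Longrightarrow> inv s \<in> S"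
    and odd: "\<And>s. s \<in> S \<Longrightarrow> F (inv s) = - F s"
  shows "(\<Sum>s\<in>S. F s) = 0"
proof -
  have "(\<Sum>s\<in>S. F s) = (\<Sum>s\<in>S. F (inv s))"
    using assms(1) closed by (intro sum.reindex_bij_witness[of _ "\<lambda>s. inv s" "\<lambda>s. inv s"]) auto
  also have "\<dots> = - (\<Sum>s\<in>S. F s)"
    by (simp add: odd sum_negf)
  finally have "2 * (\<Sum>s\<in>S. F s) = 0"
    by (metis add.right_inverse mult_2)
  then show ?thesis by simp
qed

lemma cayley_eigenvalue_odd:
  fixes \<beta> :: "'a \<Rightarrow> 'p :: prime_card padic_int"
  assumes "S \<subseteq> carrier G" "\<And>s. s \<in> S \<Longrightarrow> inv s \<in> S" "\<And>s. s \<in> S \<Longrightarrow> \<beta> (inv s) = - \<beta> s"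
    and squares: "\<not> of_nat CARD('p) dvd (\<Sum>s\<in>S. \<beta> s ^ 2)"
  obtains v where "cayley_eigenvalue S \<beta> = fps_X ^ 2 * v" "v dvd 1"
proof -
  let ?c = "cayley_eigenvalue S \<beta>"
  have sum0: "(\<Sum>s\<in>S. \<beta> s) = 0"
    using assms(1-3) by (rule sum_odd_eq_0)
  then have "?c = fps_X ^ 2 * fps_shift 2 ?c"
    by (intro fps_ext)
       (auto simp: fps_X_power_mult_nth cayley_eigenvalue_nth not_less
         simp del: add_2_eq_Suc' dest!: less_2_cases)
  moreover have "2 * fps_nth ?c 2 dvd 1"
    using squares by (simp add: cayley_eigenvalue_nth sum0 padic_int_is_unit_iff)
  then have "fps_shift 2 ?c dvd 1"
    by (auto simp: fps_is_unit_iff numeral_2_eq_2 dest: dvd_mult_right)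
  ultimately show ?thesis using that by blast
qed

lemma sum_mult_inv_right:
  fixes F :: "'a \<Rightarrow> 'c :: comm_monoid_add"
  assumes "x \<in> carrier G"
  shows "(\<Sum>y\<in>carrier G. F (x \<otimes> inv y)) = (\<Sum>s\<in>carrier G. F s)"
proof (rule sum.reindex_bij_witness[where i = "\<lambda>s. inv s \<otimes> x" and j = "\<lambda>y. x \<otimes> inv y"])
  fix s assume "s \<in> carrier G"
  with assms show "x \<otimes> inv (inv s \<otimes> x) = s"
    by (simp add: inv_mult_group m_assoc[symmetric])
qed (use assms in \<open>simp_all add: inv_mult_group m_assoc\<close>)

lemma iwasawa_matrix_cayley_row_sum:
  fixes \<beta> :: "'a \<Rightarrow> 'p :: prime_card padic_int"
  assumes S: "S \<subseteq> carrier G" and gs: "distinct gs" "set gs = carrier G" and i: "i < length gs"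
  shows "(\<Sum>j = 0..<length gs. iwasawa_matrix (cayley_graph G S) (cayley_voltage G \<beta>) gs $$ (i, j))
    = cayley_eigenvalue S \<beta>"
proof -
  define F where "F = (\<lambda>s. if s \<in> S then one_plus_T_pow (\<beta> s) else 0)"
  have gi: "gs ! i \<in> carrier G" using i gs(2) nth_mem by blast
  have "(\<Sum>j = 0..<length gs. iwasawa_matrix (cayley_graph G S) (cayley_voltage G \<beta>) gs $$ (i, j))
      = (\<Sum>j = 0..<length gs. (if i = j then of_nat (card S) else 0) - F (gs ! i \<otimes> inv (gs ! j)))"
    unfolding iwasawa_matrix_cayley[OF is_group S gs(2)]
    using i by (intro sum.cong) (auto simp: F_def)
  also have "\<dots> = of_nat (card S) - (\<Sum>j = 0..<length gs. F (gs ! i \<otimes> inv (gs ! j)))"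
    using i by (simp add: sum_subtractf)
  also have "(\<Sum>j = 0..<length gs. F (gs ! i \<otimes> inv (gs ! j))) = (\<Sum>y\<in>carrier G. F (gs ! i \<otimes> inv y))"
    using bij_betw_nth[OF gs(1) refl gs(2)[symmetric]]
    by (intro sum.reindex_bij_betw) (simp add: atLeast0LessThan)
  also have "\<dots> = (\<Sum>s\<in>carrier G. F s)"
    by (rule sum_mult_inv_right[OF gi])
  also have "\<dots> = (\<Sum>s\<in>S. one_plus_T_pow (\<beta> s))"
    using S by (intro sum.mono_neutral_cong_right) (auto simp: F_def simp flip: gs(2))
  finally show ?thesis by (simp add: cayley_eigenvalue_def sum_subtractf)
qed

lemma iwasawa_poly_cayley:
  fixes \<beta> :: "'a \<Rightarrow> 'p :: prime_card padic_int"
  assumes S: "S \<subseteq> carrier G" and gs: "distinct gs" "set gs = carrier G"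
  shows "iwasawa_poly (cayley_graph G S) (cayley_voltage G \<beta>) = cayley_eigenvalue S \<beta> *
    det (replace_col (iwasawa_matrix (cayley_graph G S) (cayley_voltage G \<beta>) gs)
      (vec (length gs) (\<lambda>_. 1)) 0)"
proof -
  let ?n = "length gs"
  let ?A = "iwasawa_matrix (cayley_graph G S) (cayley_voltage G \<beta>) gs"
  let ?ones = "vec ?n (\<lambda>_. 1) :: 'p padic_int fps vec"
  have A: "?A \<in> carrier_mat ?n ?n" by (rule iwasawa_matrix_carrier)
  have n: "0 < ?n" using gs(2) one_closed by fastforce
  have "?A *\<^sub>v ?ones = cayley_eigenvalue S \<beta> \<cdot>\<^sub>v ?ones"
    using A iwasawa_matrix_cayley_row_sum[OF assms]
    by (intro eq_vecI) (auto simp: scalar_prod_def)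
  then have "?ones $ 0 * det ?A = cayley_eigenvalue S \<beta> * det (replace_col ?A ?ones 0)"
    by (intro det_eq_eigenvalue_times_det_replace_col[OF A _ n]) simp
  moreover have "iwasawa_poly (cayley_graph G S) (cayley_voltage G \<beta>) = det ?A"
    by (intro iwasawa_poly_eq) (simp_all add: gs cayley_graph_def)
  ultimately show ?thesis using n by simp
qed

lemma iwasawa_matrix_complete_nth_0:
  fixes \<beta> :: "'a \<Rightarrow> 'p :: prime_card padic_int"
  assumes gs: "distinct gs" "set gs = carrier G"
    and ij: "i < length gs" "j < length gs"
  shows "fps_nth (iwasawa_matrix (cayley_graph G (carrier G - {\<one>})) (cayley_voltage G \<beta>) gs
      $$ (i, j)) 0 = (if i = j then of_nat (order G) else 0) - 1"
proof -
  have fin: "finite (carrier G)"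
    by (simp flip: gs(2))
  have closed: "gs ! i \<in> carrier G" "gs ! j \<in> carrier G"
    using ij gs(2) nth_mem by blast+
  then have "gs ! i \<otimes> inv (gs ! j) = \<one> \<longleftrightarrow> gs ! i = gs ! j"
    by (metis inv_closed inv_inv inv_equality r_inv)
  then have "gs ! i \<otimes> inv (gs ! j) = \<one> \<longleftrightarrow> i = j"
    using ij gs(1) by (simp add: nth_eq_iff_index_eq)
  moreover have "of_nat (card (carrier G - {\<one>})) = (of_nat (order G) - 1 :: 'p padic_int)"
    using fin order_gt_0_iff_finite by (simp add: order_def of_nat_diff)
  ultimately show ?thesis
    using ij closed unfolding iwasawa_matrix_cayley[OF is_group Diff_subset gs(2)]
    by (simp add: one_plus_T_pow_def fps_of_nat)
qed

lemma iwasawa_poly_complete: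
  fixes \<beta> :: "'a \<Rightarrow> 'p :: prime_card padic_int"
  assumes fin: "finite (carrier G)"
  obtains d where
    "iwasawa_poly (cayley_graph G (carrier G - {\<one>})) (cayley_voltage G \<beta>)
       = cayley_eigenvalue (carrier G - {\<one>}) \<beta> * d"
    "fps_nth d 0 = of_nat (order G) ^ (order G - 1)"
proof -
  obtain gs where gs: "distinct gs" "set gs = carrier G"
    using finite_distinct_list fin by blast
  then have n: "length gs = order G" "0 < length gs"
    using fin order_gt_0_iff_finite by (simp_all add: order_def flip: distinct_card)
  let ?A = "iwasawa_matrix (cayley_graph G (carrier G - {\<one>})) (cayley_voltage G \<beta>) gs"
  define d where "d = det (replace_col ?A (vec (length gs) (\<lambda>_. 1)) 0)"
  interpret nth_0: comm_ring_hom "\<lambda>f :: 'p padic_int fps. fps_nth f 0"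
    by standard simp_all
  let ?ones = "vec (length gs) (\<lambda>_. 1) :: 'p padic_int vec"
  have "map_mat (\<lambda>f. fps_nth f 0) (replace_col ?A (vec (length gs) (\<lambda>_. 1)) 0)
      = replace_col (mat (length gs) (length gs)
          (\<lambda>(i, j). (if i = j then of_nat (order G) else 0) + ?ones $ i * - 1)) ?ones 0"
    by (rule eq_matI)
       (auto simp: replace_col_def iwasawa_matrix_carrier[THEN carrier_matD(1)]
         iwasawa_matrix_carrier[THEN carrier_matD(2)] iwasawa_matrix_complete_nth_0[OF gs])
  then have "fps_nth d 0 = ?ones $ 0 * of_nat (order G) ^ (length gs - 1)"
    unfolding d_def nth_0.hom_det[symmetric]
    by (simp only: det_replace_col_rank_one_update[OF n(2) vec_carrier])
  then have "fps_nth d 0 = of_nat (order G) ^ (order G - 1)"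
    using n by simp
  then show ?thesis
    using that iwasawa_poly_cayley[OF Diff_subset gs] unfolding d_def by blast
qed

end

theorem theorem4p12:
  fixes G :: "('g, 'm) monoid_scheme" (structure)
    and n :: nat
    and \<beta> :: "'g \<Rightarrow> 'p :: prime_card padic_int"
    and C' :: "'g set"
  defines "C' \<equiv> carrier G - {\<one>}"
  assumes n: "n \<ge> 4"
    and G: "group G" "cyclic_group G" "order G = n"
    and cond1: "Modules.module.span (*) (\<beta> ` C') = UNIV"
    and cond2: "\<forall>s\<in>C'. \<beta> (inv s) = - \<beta> s"
    and cond3: "\<beta> ` C' \<subseteq> \<int>"
    and cond4: "\<exists>m>0. \<exists>h \<in> {1..m::nat} \<rightarrow> C'. (\<Otimes>i\<in>{1..m}. h i) \<in> C' \<and>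
                  \<not> of_nat CARD('p) dvd (\<beta> (\<Otimes>i\<in>{1..m}. h i) - (\<Sum>i = 1..m. \<beta> (h i)))"
    and "\<not> CARD('p) dvd n"
    and "\<not> of_nat CARD('p) dvd (\<Sum>s\<in>C'. \<beta> s ^ 2)"
  shows "mu_invariant (cayley_graph G C') (cayley_voltage G \<beta>) = 0 \<and>
         lambda_invariant (cayley_graph G C') (cayley_voltage G \<beta>) = 1"
proof -
  interpret group G by fact
  have "finite (carrier G)"
    using n G(3) order_gt_0_iff_finite by simp
  then obtain d where f: "iwasawa_poly (cayley_graph G C') (cayley_voltage G \<beta>)
      = cayley_eigenvalue C' \<beta> * d" and d0: "fps_nth d 0 = of_nat n ^ (n - 1)"
    using iwasawa_poly_complete[of \<beta>] unfolding C'_def G(3) by blast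
  obtain v where c: "cayley_eigenvalue C' \<beta> = fps_X ^ 2 * v" and v: "v dvd 1"
    using assms by (elim cayley_eigenvalue_odd[rotated 3]) auto
  have "d dvd 1"
    using assms by (simp add: fps_is_unit_iff d0 is_unit_power_iff is_unit_padic_int_of_nat)
  with v have "v * d dvd 1"
    by (simp add: is_unit_mult_iff)
  moreover have "iwasawa_poly (cayley_graph G C') (cayley_voltage G \<beta>)
      = fps_X * (of_nat CARD('p) ^ 0 * fps_of_poly [:0, 1:] * (v * d))"
    by (simp add: f c power2_eq_square ac_simps)
  moreover have "cayley_voltage G \<beta> ` arcs (cayley_graph G C') \<subseteq> \<int>"
    using cayley_voltage_arcs_subset cond3 by (rule subset_trans)
  moreover have "distinguished [:0, 1 :: 'p padic_int:]"
    by (simp add: distinguished_def)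
  ultimately have "mu_invariant (cayley_graph G C') (cayley_voltage G \<beta>) = 0"
    and "lambda_invariant (cayley_graph G C') (cayley_voltage G \<beta>)
      = degree [:0, 1 :: 'p padic_int:]"
    by (blast intro: mu_lambda_invariant_eqI)+
  then show ?thesis by simp
qed

end
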